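(* Let $n\in\mathbb{N}_0=\{0,1,2,\dots\}$ and let $\nu>n-1$ be real. The following statements hold. (a) $r^\ast(g_{\nu,n})$ satisfies the inequalities $$r^\ast(g_{\nu,n})<\sqrt{\frac{2(\nu-n+2)(\nu-n+1)}{\nu+2}},$$ $$2\sqrt{\frac{(\nu-n+2)(\nu-n+1)}{3(\nu+2)}}<r^\ast(g_{\nu,n})<2\sqrt{\frac{1}{\frac{3(\nu+2)}{(\nu-n+2)(\nu-n+1)}-\frac{5(\nu+4)(\nu+3)}{3(\nu-n+4)(\nu-n+3)(\nu+2)}}}.$$ (b) $r^\ast(h_{\nu,n})$ satisfies the inequalities $$r^\ast(h_{\nu,n})<\frac{4(\nu-n+2)(\nu-n+1)}{\nu+2},$$ $$\frac{2(\nu-n+2)(\nu-n+1)}{\nu+2}<r^\ast(h_{\nu,n})<\frac{2}{\frac{\nu+2}{(\nu-n+2)(\nu-n+1)}-\frac{3(\nu+4)(\nu+3)}{4(\nu-n+4)(\nu-n+3)(\nu+2)}}.$$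
   Context: $J_\nu(z)=\sum_{m\ge 0}\frac{(-1)^m}{m!\,\Gamma(m+\nu+1)}\left(\frac z2\right)^{2m+\nu}$ is the Bessel function of the first kind of order $\nu$, and $J_\nu^{(n)}$ is its $n$th derivative. For $\nu>n-1$ define the entire functions $$g_{\nu,n}(z)=2^\nu\Gamma(\nu-n+1)z^{1+n-\nu}J_\nu^{(n)}(z)=\sum_{m\ge0}\frac{(-1)^m\Gamma(2m+\nu+1)\Gamma(\nu-n+1)}{m!\,4^m\,\Gamma(2m-n+\nu+1)\Gamma(m+\nu+1)}z^{2m+1},$$ $$h_{\nu,n}(z)=2^\nu\Gamma(\nu-n+1)z^{1+\frac{n-\nu}2}J_\nu^{(n)}(\sqrt z)=\sum_{m\ge0}\frac{(-1)^m\Gamma(2m+\nu+1)\Gamma(\nu-n+1)}{m!\,4^m\,\Gamma(2m-n+\nu+1)\Gamma(m+\nu+1)}z^{m+1}.$$ For an entire function $f$ with $f(0)=0$, $f'(0)=1$, the radius of starlikeness (of order $0$) is $$r^\ast(f)=\sup\left\{r>0:\ \mathrm{Re}\left(\frac{zf'(z)}{f(z)}\right)>0\ \text{for all } z\in\mathbb{D}_r\right\},\qquad \mathbb{D}_r=\{z\in\mathbb{C}:|z|<r\},$$ where $zf'(z)/f(z)$ takes the value $1$ at $z=0$. *)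

theory Defs
  imports "HOL-Complex_Analysis.Complex_Analysis"
begin

text \<open>
  Principal branch: for non-integer order the cut is the nonpositive real axis. At the poles
  of \<^const>\<open>Gamma\<close> the convention \<open>1 / 0 = 0\<close> gives the usual value of \<open>1 / Gamma\<close>. The case
  distinction only repairs \<open>0 powr 0 = 0\<close>, so that the function of order 0 is 1 at the origin.
\<close>
definition bessel_J :: "real \<Rightarrow> complex \<Rightarrow> complex" where
  "bessel_J \<nu> z = (if \<nu> = 0 then 1 else (z / 2) powr of_real \<nu>) *
     (\<Sum>m. (-1) ^ m / (fact m * Gamma (of_nat m + of_real \<nu> + 1)) * (z / 2) ^ (2 * m))"

text \<open>
  The formulas defining \<open>g_bessel\<close> and \<open>h_bessel\<close> are products of principal branches, which
  are discontinuous on the nonpositive real axis for general order. Off that axis they agree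
  with a unique entire function (existence: \<open>g_bessel_eser\<close>, \<open>h_bessel_eser\<close>), which is the
  function meant.
\<close>
definition entire_extension :: "(complex \<Rightarrow> complex) \<Rightarrow> complex \<Rightarrow> complex" where
  "entire_extension F =
     (THE f. f holomorphic_on UNIV \<and> (\<forall>z. z \<notin> \<real>\<^sub>\<le>\<^sub>0 \<longrightarrow> f z = F z))"

definition g_bessel :: "real \<Rightarrow> nat \<Rightarrow> complex \<Rightarrow> complex" where
  "g_bessel \<nu> n = entire_extension (\<lambda>z.
     of_real (2 powr \<nu> * Gamma (\<nu> - real n + 1)) *
     z powr of_real (1 + real n - \<nu>) * (deriv ^^ n) (bessel_J \<nu>) z)"

definition h_bessel :: "real \<Rightarrow> nat \<Rightarrow> complex \<Rightarrow> complex" where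
  "h_bessel \<nu> n = entire_extension (\<lambda>z.
     of_real (2 powr \<nu> * Gamma (\<nu> - real n + 1)) *
     z powr of_real (1 + (real n - \<nu>) / 2) * (deriv ^^ n) (bessel_J \<nu>) (csqrt z))"

text \<open>
  The supremum is taken in the extended reals, so it is \<open>\<infinity>\<close> for an unbounded set of radii.
  At a zero \<open>z \<noteq> 0\<close> of \<open>f\<close> the quotient is 0, so such a point violates the condition.
\<close>
definition starlike_radius :: "(complex \<Rightarrow> complex) \<Rightarrow> ereal" where
  "starlike_radius f = Sup (ereal ` {r. r > 0 \<and>
     (\<forall>z. cmod z < r \<longrightarrow> Re (if z = 0 then 1 else z * deriv f z / f z) > 0)})"

text \<open>
  The entire extensions exist and are given by the power series with coefficients \<open>bcoeff\<close>
  (\<open>g_bessel_sums\<close>, \<open>h_bessel_sums\<close>).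
\<close>

lemma entire_extension_eqI:
  assumes "f holomorphic_on UNIV" "\<And>z. z \<notin> \<real>\<^sub>\<le>\<^sub>0 \<Longrightarrow> f z = F z"
  shows "entire_extension F = f"
  unfolding entire_extension_def
proof (rule the_equality)
  show "f holomorphic_on UNIV \<and> (\<forall>z. z \<notin> \<real>\<^sub>\<le>\<^sub>0 \<longrightarrow> f z = F z)"
    using assms by blast
next
  fix g assume g: "g holomorphic_on UNIV \<and> (\<forall>z. z \<notin> \<real>\<^sub>\<le>\<^sub>0 \<longrightarrow> g z = F z)"
  show "g = f"
  proof
    fix z
    have ne: "- \<real>\<^sub>\<le>\<^sub>0 \<noteq> ({} :: complex set)"
      by (auto simp: complex_nonpos_Reals_iff intro!: exI[of _ 1])
    show "g z = f z"
      by (rule analytic_continuation_open[of "- \<real>\<^sub>\<le>\<^sub>0" UNIV]) (use g assms ne in auto)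
  qed
qed

definition bcoeff :: "real \<Rightarrow> nat \<Rightarrow> nat \<Rightarrow> real" where
  "bcoeff \<nu> n m = (-1) ^ m * Gamma (2 * real m + \<nu> + 1) * Gamma (\<nu> - real n + 1) /
     (fact m * 4 ^ m * Gamma (2 * real m - real n + \<nu> + 1) * Gamma (real m + \<nu> + 1))"

definition ecoeff :: "real \<Rightarrow> nat \<Rightarrow> nat \<Rightarrow> complex" where
  "ecoeff \<nu> n m = (-1) ^ m / (fact m * Gamma (of_nat m + of_real \<nu> + 1) * 4 ^ m) *
     (\<Prod>j<n. 2 * of_nat m + of_real \<nu> - of_nat j)"

lemma ecoeff_Suc:
  "ecoeff \<nu> (Suc n) m = ecoeff \<nu> n m * (2 * of_nat m + (of_real \<nu> - of_nat n))"
  by (simp add: ecoeff_def add_diff_eq mult.assoc)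

lemma Gamma_pos_Suc:
  fixes x :: real
  assumes "x > 0"
  shows "Gamma (x + 1) = x * Gamma x"
  using assms by (intro Gamma_plus1) (auto elim!: nonpos_Ints_cases)

lemma ecoeff_bcoeff:
  assumes "\<nu> > real n - 1"
  shows "of_real (Gamma (\<nu> - real n + 1)) * ecoeff \<nu> n m = of_real (bcoeff \<nu> n m)"
proof -
  define x where "x = 2 * real m + \<nu> + 1"
  have pr: "(\<Prod>j<k. x - 1 - real j) * Gamma (x - real k) = Gamma x" if "real k < x" for k
    using that
  proof (induction k)
    case (Suc k)
    have "Gamma (x - real k) = (x - real (Suc k)) * Gamma (x - real (Suc k))"
      using Gamma_pos_Suc[of "x - real (Suc k)"] Suc.prems by (simp add: algebra_simps)
    with Suc show ?case by (simp add: algebra_simps)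
  qed simp
  have xn: "real n < x" using assms by (simp add: x_def)
  have "Gamma (x - real n) > 0" using xn by (intro Gamma_real_pos) simp
  hence "(\<Prod>j<n. 2 * real m + \<nu> - real j) =
      Gamma (2 * real m + \<nu> + 1) / Gamma (2 * real m - real n + \<nu> + 1)"
    using pr[OF xn] by (simp add: x_def field_simps)
  moreover have "ecoeff \<nu> n m = of_real ((-1) ^ m / (fact m * Gamma (real m + \<nu> + 1) * 4 ^ m) *
     (\<Prod>j<n. 2 * real m + \<nu> - real j))"
    by (simp add: ecoeff_def flip: Gamma_complex_of_real)
  ultimately show ?thesis
    by (simp add: bcoeff_def field_simps)
qed

lemma summable_ecoeff:
  assumes "\<nu> > -1"
  shows "summable (\<lambda>m. ecoeff \<nu> n m * w ^ m)"
proof (induction n arbitrary: w)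
  case 0
  define N where "N = nat \<lceil>norm w - \<nu>\<rceil>"
  show ?case
  proof (rule summable_ratio_test[of "1/4" N])
    fix m assume "m \<ge> N"
    hence *: "norm w \<le> real m + \<nu> + 1" unfolding N_def by linarith
    have pos: "real m + \<nu> + 1 > 0" using assms by simp
    have G: "Gamma (complex_of_real (real m + \<nu> + 1) + 1) =
        of_real (real m + \<nu> + 1) * Gamma (of_real (real m + \<nu> + 1))"
      using arg_cong[OF Gamma_pos_Suc[OF pos], of complex_of_real]
      by (simp flip: Gamma_complex_of_real)
    have n1: "norm (complex_of_real (real m + \<nu> + 1)) = real m + \<nu> + 1"
      using pos by (simp only: norm_of_real abs_of_pos)
    have eq: "ecoeff \<nu> 0 (Suc m) * w ^ Suc m =
       (ecoeff \<nu> 0 m * w ^ m) * (- w / (4 * of_nat (Suc m) * of_real (real m + \<nu> + 1)))"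
      using G by (simp add: ecoeff_def algebra_simps)
    have "norm w / (4 * real (Suc m) * (real m + \<nu> + 1)) \<le> 1 / 4"
    proof -
      have "norm w \<le> 1 * (real m + \<nu> + 1)" using * by simp
      also have "\<dots> \<le> real (Suc m) * (real m + \<nu> + 1)"
        using pos by (intro mult_right_mono) auto
      finally have "norm w \<le> real (Suc m) * (real m + \<nu> + 1)" .
      moreover have "real (Suc m) * (real m + \<nu> + 1) > 0"
        using pos by (intro mult_pos_pos) auto
      ultimately have "norm w / (4 * (real (Suc m) * (real m + \<nu> + 1))) \<le> 1 / 4"
        by (simp add: pos_divide_le_eq del: of_nat_Suc)
      thus ?thesis by (simp only: mult.assoc)
    qed
    hence "norm (- w / (4 * of_nat (Suc m) * of_real (real m + \<nu> + 1))) \<le> 1 / 4"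
      by (simp only: norm_divide norm_minus_cancel norm_mult n1 norm_of_nat norm_numeral)
    from mult_left_mono[OF this norm_ge_zero[of "ecoeff \<nu> 0 m * w ^ m"]]
    show "norm (ecoeff \<nu> 0 (Suc m) * w ^ Suc m) \<le> 1 / 4 * norm (ecoeff \<nu> 0 m * w ^ m)"
      unfolding eq norm_mult by (simp add: mult_ac)
  qed simp
next
  case (Suc n)
  have "summable (\<lambda>m. diffs (ecoeff \<nu> n) m * w ^ m)"
    by (rule termdiff_converges_all) (rule Suc)
  from diffs_equiv[OF this]
  have "summable (\<lambda>m. 2 * w * (of_nat m * ecoeff \<nu> n m * w ^ (m - Suc 0)))"
    by (intro summable_mult) (auto simp: sums_iff)
  moreover have "summable (\<lambda>m. (of_real \<nu> - of_nat n) * (ecoeff \<nu> n m * w ^ m))"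
    by (intro summable_mult Suc)
  ultimately have "summable (\<lambda>m. 2 * w * (of_nat m * ecoeff \<nu> n m * w ^ (m - Suc 0)) +
      (of_real \<nu> - of_nat n) * (ecoeff \<nu> n m * w ^ m))"
    by (rule summable_add)
  also have "(\<lambda>m. 2 * w * (of_nat m * ecoeff \<nu> n m * w ^ (m - Suc 0)) +
      (of_real \<nu> - of_nat n) * (ecoeff \<nu> n m * w ^ m)) =
      (\<lambda>m. ecoeff \<nu> (Suc n) m * w ^ m)"
  proof
    fix m show "2 * w * (of_nat m * ecoeff \<nu> n m * w ^ (m - Suc 0)) +
      (of_real \<nu> - of_nat n) * (ecoeff \<nu> n m * w ^ m) = ecoeff \<nu> (Suc n) m * w ^ m"
      by (cases m) (simp_all add: ecoeff_Suc algebra_simps)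
  qed
  finally show ?case .
qed

definition eser :: "real \<Rightarrow> nat \<Rightarrow> complex \<Rightarrow> complex" where
  "eser \<nu> n w = (\<Sum>m. ecoeff \<nu> n m * w ^ m)"

lemma eser_deriv:
  assumes "\<nu> > -1"
  obtains D where "(eser \<nu> n has_field_derivative D) (at w)"
    "eser \<nu> (Suc n) w = 2 * w * D + (of_real \<nu> - of_nat n) * eser \<nu> n w"
proof
  let ?D = "\<Sum>m. diffs (ecoeff \<nu> n) m * w ^ m"
  show "(eser \<nu> n has_field_derivative ?D) (at w)"
    unfolding eser_def
    by (intro termdiffs_strong_converges_everywhere summable_ecoeff assms)
  have "summable (\<lambda>m. diffs (ecoeff \<nu> n) m * w ^ m)"
    by (intro termdiff_converges_all summable_ecoeff assms)
  from sums_mult[OF diffs_equiv[OF this], of "2 * w"]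
    sums_mult[OF summable_sums[OF summable_ecoeff[OF assms, of n w]], of "of_real \<nu> - of_nat n"]
  have "(\<lambda>m. 2 * w * (of_nat m * ecoeff \<nu> n m * w ^ (m - Suc 0)) +
      (of_real \<nu> - of_nat n) * (ecoeff \<nu> n m * w ^ m)) sums
      (2 * w * ?D + (of_real \<nu> - of_nat n) * eser \<nu> n w)"
    unfolding eser_def by (rule sums_add)
  also have "(\<lambda>m. 2 * w * (of_nat m * ecoeff \<nu> n m * w ^ (m - Suc 0)) +
      (of_real \<nu> - of_nat n) * (ecoeff \<nu> n m * w ^ m)) =
      (\<lambda>m. ecoeff \<nu> (Suc n) m * w ^ m)"
  proof
    fix m show "2 * w * (of_nat m * ecoeff \<nu> n m * w ^ (m - Suc 0)) +
      (of_real \<nu> - of_nat n) * (ecoeff \<nu> n m * w ^ m) = ecoeff \<nu> (Suc n) m * w ^ m"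
      by (cases m) (simp_all add: ecoeff_Suc algebra_simps)
  qed
  finally show "eser \<nu> (Suc n) w = 2 * w * ?D + (of_real \<nu> - of_nat n) * eser \<nu> n w"
    unfolding eser_def by (simp add: sums_iff)
qed

lemma holomorphic_eser: "\<nu> > -1 \<Longrightarrow> eser \<nu> n holomorphic_on UNIV"
  by (auto simp: holomorphic_on_open elim: eser_deriv)

lemma deriv_bessel_J:
  assumes "\<nu> > -1" "z \<notin> \<real>\<^sub>\<le>\<^sub>0"
  shows "(deriv ^^ n) (bessel_J \<nu>) z =
    z powr (of_real \<nu> - of_nat n) / of_real (2 powr \<nu>) * eser \<nu> n (z ^ 2)"
  using assms(2)
proof (induction n arbitrary: z)
  case 0
  hence "z \<noteq> 0" by auto
  have "(of_real (1/2) * z) powr of_real \<nu> = of_real (1/2) powr of_real \<nu> * z powr of_real \<nu>"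
    by (rule powr_times_real_left) auto
  also have "complex_of_real (1/2) powr of_real \<nu> = of_real ((1/2) powr \<nu>)"
    by (rule powr_of_real) auto
  also have "(1/2) powr \<nu> = 1 / 2 powr \<nu>"
    by (simp add: powr_divide)
  finally have p: "(z / 2) powr of_real \<nu> = z powr of_real \<nu> / of_real (2 powr \<nu>)"
    by simp
  have "(-1) ^ m / (fact m * Gamma (of_nat m + of_real \<nu> + 1)) * (z / 2) ^ (2 * m) =
     ecoeff \<nu> 0 m * (z\<^sup>2) ^ m" for m
    unfolding power_mult by (simp add: ecoeff_def power_divide mult_ac flip: power_mult)
  with p \<open>z \<noteq> 0\<close> show ?case by (auto simp: bessel_J_def eser_def)
next
  case (Suc n)
  let ?F = "\<lambda>z. z powr (of_real \<nu> - of_nat n) / of_real (2 powr \<nu>) * eser \<nu> n (z ^ 2)"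
  obtain D where D: "(eser \<nu> n has_field_derivative D) (at (z^2))"
    "eser \<nu> (Suc n) (z^2) = 2 * z^2 * D + (of_real \<nu> - of_nat n) * eser \<nu> n (z^2)"
    using eser_deriv[OF assms(1)] by metis
  have z: "z \<noteq> 0" using Suc.prems by auto
  have "\<forall>\<^sub>F w in nhds z. w \<in> - \<real>\<^sub>\<le>\<^sub>0"
    using Suc.prems by (intro eventually_nhds_in_open) (auto simp: open_Compl)
  hence ev: "\<forall>\<^sub>F w in nhds z. (deriv ^^ n) (bessel_J \<nu>) w = ?F w"
    by (rule eventually_mono) (use Suc.IH in auto)
  have pw: "z powr (of_real \<nu> - of_nat n) = z * z powr (of_real \<nu> - of_nat n - 1)"
    using z by (simp add: powr_diff)
  have "((\<lambda>z. eser \<nu> n (z^2)) has_field_derivative D * (2 * z)) (at z)"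
    by (rule DERIV_chain2[where f = "eser \<nu> n" and g = "\<lambda>z. z^2"], rule D(1))
      (auto intro!: derivative_eq_intros)
  hence "(?F has_field_derivative
     (of_real \<nu> - of_nat n) * z powr (of_real \<nu> - of_nat n - 1) / of_real (2 powr \<nu>) * eser \<nu> n (z^2) +
     D * (2 * z) * (z powr (of_real \<nu> - of_nat n) / of_real (2 powr \<nu>))) (at z)"
    by (intro DERIV_mult DERIV_cdivide has_field_derivative_powr Suc.prems)
  hence "deriv ?F z = z powr (of_real \<nu> - of_nat n - 1) / of_real (2 powr \<nu>) * eser \<nu> (Suc n) (z^2)"
    unfolding D(2) pw by (subst DERIV_imp_deriv) (auto simp: field_simps power2_eq_square)
  moreover have "(deriv ^^ Suc n) (bessel_J \<nu>) z = deriv ?F z"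
    using deriv_cong_ev[OF ev] by simp
  ultimately show ?case by (simp add: algebra_simps)
qed

lemma g_bessel_eser:
  assumes "\<nu> > real n - 1"
  shows "g_bessel \<nu> n = (\<lambda>z. of_real (Gamma (\<nu> - real n + 1)) * z * eser \<nu> n (z^2))"
  unfolding g_bessel_def
proof (rule entire_extension_eqI)
  have \<nu>: "\<nu> > -1" using assms by linarith
  show "(\<lambda>z. of_real (Gamma (\<nu> - real n + 1)) * z * eser \<nu> n (z^2)) holomorphic_on UNIV"
    using holomorphic_on_compose_gen[OF _ holomorphic_eser[OF \<nu>], of "\<lambda>z. z^2" UNIV n]
    by (intro holomorphic_intros) (auto simp: o_def holomorphic_on_power[OF holomorphic_on_ident])
  fix z :: complex assume z: "z \<notin> \<real>\<^sub>\<le>\<^sub>0"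
  hence "z \<noteq> 0" by auto
  have "z powr of_real (1 + real n - \<nu>) * z powr (of_real \<nu> - of_nat n) = z"
    using \<open>z \<noteq> 0\<close> by (simp flip: powr_add)
  thus "of_real (Gamma (\<nu> - real n + 1)) * z * eser \<nu> n (z^2) =
      of_real (2 powr \<nu> * Gamma (\<nu> - real n + 1)) *
     z powr of_real (1 + real n - \<nu>) * (deriv ^^ n) (bessel_J \<nu>) z"
    unfolding deriv_bessel_J[OF \<nu> z] by (simp add: field_simps)
qed

lemma h_bessel_eser:
  assumes "\<nu> > real n - 1"
  shows "h_bessel \<nu> n = (\<lambda>z. of_real (Gamma (\<nu> - real n + 1)) * z * eser \<nu> n z)"
  unfolding h_bessel_def
proof (rule entire_extension_eqI)
  have \<nu>: "\<nu> > -1" using assms by linarith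
  show "(\<lambda>z. of_real (Gamma (\<nu> - real n + 1)) * z * eser \<nu> n z) holomorphic_on UNIV"
    using holomorphic_eser[OF \<nu>] by (intro holomorphic_intros)
  fix z :: complex assume z: "z \<notin> \<real>\<^sub>\<le>\<^sub>0"
  hence "z \<noteq> 0" by auto
  have cs: "csqrt z \<notin> \<real>\<^sub>\<le>\<^sub>0" using \<open>z \<noteq> 0\<close> by simp
  have "Ln (csqrt z) = Ln z / 2"
    unfolding csqrt_exp_Ln[OF \<open>z \<noteq> 0\<close>]
    using \<open>z \<noteq> 0\<close> mpi_less_Im_Ln[of z] Im_Ln_le_pi[of z] pi_gt_zero
    by (intro Ln_exp) (auto simp del: pi_gt_zero)
  hence "csqrt z powr (of_real \<nu> - of_nat n) = z powr ((of_real \<nu> - of_nat n) / 2)"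
    using \<open>z \<noteq> 0\<close> by (simp add: powr_def del: eq_divide_eq_numeral1)
  moreover have "z powr of_real (1 + (real n - \<nu>) / 2) * z powr ((of_real \<nu> - of_nat n) / 2) = z"
    using \<open>z \<noteq> 0\<close> by (simp add: field_simps flip: powr_add)
  ultimately show "of_real (Gamma (\<nu> - real n + 1)) * z * eser \<nu> n z =
      of_real (2 powr \<nu> * Gamma (\<nu> - real n + 1)) *
     z powr of_real (1 + (real n - \<nu>) / 2) * (deriv ^^ n) (bessel_J \<nu>) (csqrt z)"
    unfolding deriv_bessel_J[OF \<nu> cs] by (simp add: field_simps)
qed

lemma g_bessel_sums:
  assumes "\<nu> > real n - 1"
  shows "(\<lambda>m. of_real (bcoeff \<nu> n m) * z ^ (2 * m + 1)) sums g_bessel \<nu> n z"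
proof -
  have \<nu>: "\<nu> > -1" using assms by linarith
  have "(\<lambda>m. of_real (Gamma (\<nu> - real n + 1)) * z * (ecoeff \<nu> n m * (z^2) ^ m)) sums
      g_bessel \<nu> n z"
    unfolding g_bessel_eser[OF assms] eser_def
    by (intro sums_mult summable_sums summable_ecoeff \<nu>)
  thus ?thesis
    unfolding ecoeff_bcoeff[OF assms, symmetric] power_add power_mult by (simp add: mult_ac)
qed

lemma h_bessel_sums:
  assumes "\<nu> > real n - 1"
  shows "(\<lambda>m. of_real (bcoeff \<nu> n m) * z ^ (m + 1)) sums h_bessel \<nu> n z"
proof -
  have \<nu>: "\<nu> > -1" using assms by linarith
  have "(\<lambda>m. of_real (Gamma (\<nu> - real n + 1)) * z * (ecoeff \<nu> n m * z ^ m)) sums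
      h_bessel \<nu> n z"
    unfolding h_bessel_eser[OF assms] eser_def
    by (intro sums_mult summable_sums summable_ecoeff \<nu>)
  thus ?thesis
    unfolding ecoeff_bcoeff[OF assms, symmetric] by (simp add: mult_ac)
qed

end

theory Submission
  imports Defs
begin

text \<open>
  Both functions have the form \<open>z * A (- S * z ^ p)\<close> with \<open>p = 2\<close> for \<open>g\<close>, \<open>p = 1\<close> for \<open>h\<close> and
  \<open>A v = (\<Sum>k. a k * v ^ k)\<close>, where \<open>a k = q 0 * \<dots> * q (k - 1) / k!\<close>, \<open>q 0 = 1\<close>, \<open>q\<close> is
  positive and decreasing and \<open>(1 - q k) / k\<close> is decreasing. With \<open>B v = v * A' v\<close> the quotient
  \<open>z * f' z / f z\<close> is \<open>1 + p * B v / A v\<close> at \<open>v = - S * z ^ p\<close>, so no information on the zeros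
  of the Bessel function derivatives is required: in terms of \<open>t = S * r ^ p\<close> the lower bound is
  \<open>1 / (p + 1)\<close> and follows from a coefficientwise estimate after multiplication by \<open>1 - v\<close>.
  The upper bounds follow from the sign of \<open>A + p * B\<close> at \<open>- t\<close>: the alternating series of
  \<open>t * A (- t) + B (- t)\<close> is negative for \<open>0 < t \<le> 1\<close>, which gives \<open>1 / p\<close>, and
  truncating \<open>A + p * B\<close> after the quadratic term gives the other one.
\<close>

section \<open>Alternating series, and power series multiplied by \<open>1 - v\<close>\<close>

lemma alternating_suminf_le:
  fixes e :: "nat \<Rightarrow> real"
  assumes "summable (\<lambda>k. (-1) ^ k * e k)" "\<And>k. 0 \<le> e k" "\<And>k. e (Suc k) \<le> e k"
  shows "(\<Sum>k. (-1) ^ k * e k) \<le> e 0" "e 0 - e 1 \<le> (\<Sum>k. (-1) ^ k * e k)"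
proof -
  have "(\<lambda>k. \<bar>(-1) ^ k * e k\<bar>) \<longlonglongrightarrow> 0"
    using tendsto_rabs_zero[OF summable_LIMSEQ_zero[OF assms(1)]] .
  hence lim: "e \<longlonglongrightarrow> 0"
    using assms(2) by (simp add: abs_mult)
  note L = summable_Leibniz'[OF lim assms(2) assms(3)]
  show "(\<Sum>k. (-1) ^ k * e k) \<le> e 0" using L(4)[of 0] by simp
  show "e 0 - e 1 \<le> (\<Sum>k. (-1) ^ k * e k)" using L(2)[of 1] by (simp add: numeral_2_eq_2)
qed

lemma one_minus_times_sums:
  fixes v :: "'a :: real_normed_field"
  assumes "(\<lambda>k. c k * v ^ k) sums s"
  shows "(\<lambda>k. (c (Suc k) - c k) * v ^ Suc k) sums ((1 - v) * s - c 0)"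
proof -
  have "(\<lambda>k. c (Suc k) * v ^ Suc k) sums (s - c 0)"
    using assms by (subst sums_Suc_iff) simp
  from sums_diff[OF this sums_mult[OF assms, of v]] show ?thesis
    by (simp add: algebra_simps)
qed

text \<open>The factor \<open>1 - v\<close> turns the coefficients into differences
  \<open>b (Suc k) - b k\<close>, nonnegative for \<open>k = 0\<close> and nonpositive afterwards.
  Their absolute values, weighted by powers of \<open>t\<close>, therefore sum to the negative of
  the same series at \<open>t\<close>, corrected in one term.\<close>

lemma norm_one_minus_times_powser:
  fixes b :: "nat \<Rightarrow> real" and v V :: complex
  assumes T: "(\<lambda>k. b k * t ^ k) sums T"
    and V: "(\<lambda>k. of_real (b k) * v ^ k) sums V"
    and b01: "b 0 \<le> b 1" and dec: "\<And>k. k \<ge> 1 \<Longrightarrow> b (Suc k) \<le> b k"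
    and v: "norm v \<le> t"
  shows "norm ((1 - v) * V - of_real (b 0)) \<le> 2 * (b 1 - b 0) * t - ((1 - t) * T - b 0)"
proof -
  have c: "(\<lambda>k. of_real (b (Suc k) - b k) * v ^ Suc k) sums ((1 - v) * V - of_real (b 0))"
    using one_minus_times_sums[OF V] by (simp only: of_real_diff)
  \<comment> \<open>Restores the sign of the term \<open>k = 0\<close> when the series at
    \<open>t\<close> is subtracted.\<close>
  have "(\<lambda>k. if k = 0 then 2 * (b 1 - b 0) * t else 0) sums (2 * (b 1 - b 0) * t)"
    using sums_single[of 0 "\<lambda>_. 2 * (b 1 - b 0) * t"] by simp
  note R = sums_diff[OF this one_minus_times_sums[OF T]]
  have le: "norm (of_real (b (Suc k) - b k) * v ^ Suc k :: complex) \<le>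
      (if k = 0 then 2 * (b 1 - b 0) * t else 0) - (b (Suc k) - b k) * t ^ Suc k" for k
  proof -
    have "norm (of_real (b (Suc k) - b k) * v ^ Suc k :: complex)
        = \<bar>b (Suc k) - b k\<bar> * norm v ^ Suc k"
      by (simp only: norm_mult norm_power norm_of_real)
    also have "\<dots> \<le> \<bar>b (Suc k) - b k\<bar> * t ^ Suc k"
      by (intro mult_left_mono power_mono v) auto
    also have "\<dots> = (if k = 0 then 2 * (b 1 - b 0) * t else 0) - (b (Suc k) - b k) * t ^ Suc k"
      using b01 dec[of k] by (cases "k = 0") (auto simp: algebra_simps abs_if)
    finally show ?thesis .
  qed
  show ?thesis
    using norm_suminf_le[OF le sums_summable[OF R]] sums_unique[OF c] sums_unique[OF R] by simp
qed

section \<open>Power series with normalized coefficient ratios\<close>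

text \<open>Clearing denominators in \<open>q_slope\<close> admits \<open>k = 0\<close>, where it is
  trivial. All conditions pass to products (\<open>normalized_ratios_mult\<close>), so they can be
  checked factor by factor.\<close>

locale normalized_ratios =
  fixes q :: "nat \<Rightarrow> real"
  assumes q_0: "q 0 = 1"
    and q_pos: "\<And>k. 0 < q k"
    and q_Suc_le: "\<And>k. q (Suc k) \<le> q k"
    and q_slope: "\<And>k. real k * (1 - q (Suc k)) \<le> (real k + 1) * (1 - q k)"
begin

lemma q_le_1: "q k \<le> 1"
  using q_0 q_Suc_le by (induction k) (auto intro: order_trans)

definition a :: "nat \<Rightarrow> real" where
  "a k = (\<Prod>j<k. q j) / fact k"

lemma a_0 [simp]: "a 0 = 1" and a_1 [simp]: "a (Suc 0) = 1" and a_2: "a 2 = q 1 / 2"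
  by (simp_all add: a_def q_0 numeral_2_eq_2)

lemma a_Suc: "a (Suc k) = a k * q k / (real k + 1)"
  by (simp add: a_def field_simps)

lemma a_pos: "0 < a k"
  by (auto simp: a_def intro!: divide_pos_pos prod_pos q_pos)

lemma a_le: "a k \<le> 1 / fact k"
  unfolding a_def by (intro divide_right_mono prod_le_1) (auto simp: q_pos less_imp_le q_le_1)

lemma summable_a:
  fixes v :: "'b :: {banach, real_normed_field}"
  shows "summable (\<lambda>k. of_real (a k) * v ^ k)"
proof (rule summable_comparison_test')
  show "summable (\<lambda>k. norm v ^ k / fact k)"
    using summable_exp[of "norm v"] by (simp add: field_simps)
  show "norm (of_real (a k) * v ^ k) \<le> norm v ^ k / fact k" for k
    using mult_right_mono[OF a_le[of k], of "norm v ^ k"] a_pos[of k]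
    by (simp add: norm_mult norm_power)
qed

text \<open>Polymorphic because the sign and continuity arguments run over the reals and
  starlikeness over the complex numbers; \<open>A_of_real\<close> links the two.\<close>

definition A :: "'b \<Rightarrow> 'b :: {banach, real_normed_field}" where
  "A v = (\<Sum>k. of_real (a k) * v ^ k)"

definition B :: "'b \<Rightarrow> 'b :: {banach, real_normed_field}" where
  "B v = (\<Sum>k. of_real (real k * a k) * v ^ k)"

lemma A_sums: "(\<lambda>k. of_real (a k) * v ^ k) sums A v"
  unfolding A_def by (intro summable_sums summable_a)

lemma A_deriv:
  fixes v :: "'b :: {banach, real_normed_field}"
  obtains D where "(A has_field_derivative D) (at v)" "v * D = B v"
    "(\<lambda>k. of_real (real k * a k) * v ^ k) sums B v"
proof
  let ?D = "\<Sum>k. diffs (\<lambda>k. of_real (a k)) k * v ^ k"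
  show "(A has_field_derivative ?D) (at v)"
    unfolding A_def
    by (intro termdiffs_strong_converges_everywhere summable_a)
  have "summable (\<lambda>k. diffs (\<lambda>k. of_real (a k)) k * v ^ k)"
    by (intro termdiff_converges_all summable_a)
  from sums_mult[OF diffs_equiv[OF this], of v]
  have "(\<lambda>k. v * (of_nat k * of_real (a k) * v ^ (k - Suc 0))) sums (v * ?D)" .
  also have "(\<lambda>k. v * (of_nat k * of_real (a k) * v ^ (k - Suc 0))) =
      (\<lambda>k. of_real (real k * a k) * v ^ k)"
  proof
    fix k show "v * (of_nat k * of_real (a k) * v ^ (k - Suc 0)) = of_real (real k * a k) * v ^ k"
      by (cases k) simp_all
  qed
  finally have s: "(\<lambda>k. of_real (real k * a k) * v ^ k) sums (v * ?D)" .
  thus "v * ?D = B v" unfolding B_def by (simp add: sums_iff)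
  thus "(\<lambda>k. of_real (real k * a k) * v ^ k) sums B v" using s by simp
qed

lemma B_sums: "(\<lambda>k. of_real (real k * a k) * v ^ k) sums B v"
  using A_deriv by metis

lemma A_of_real: "A (of_real x :: 'b :: {banach, real_normed_field}) = of_real (A x)"
  using sums_of_real[OF A_sums[of x], where 'a = 'b] A_sums[of "of_real x :: 'b"]
  by (simp add: sums_iff)

lemma B_of_real: "B (of_real x :: 'b :: {banach, real_normed_field}) = of_real (B x)"
  using sums_of_real[OF B_sums[of x], where 'a = 'b] B_sums[of "of_real x :: 'b"]
  by (simp add: sums_iff)

lemma A_0 [simp]: "A 0 = 1"
  using A_sums[of 0] by (simp add: sums_iff powser_zero)

lemma isCont_A: "isCont A (v :: real)"
  using A_deriv DERIV_isCont by metis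

lemma isCont_B: "isCont B (v :: real)"
  unfolding B_def
proof (rule isCont_powser_converges_everywhere)
  show "summable (\<lambda>k. of_real (real k * a k) * y ^ k)" for y :: real
    using B_sums[of y] sums_summable by blast
qed

section \<open>Estimates for combinations of \<open>A\<close> and \<open>B\<close>\<close>

lemma A_plus_B_sums:
  "(\<lambda>k. of_real ((c + d * real k) * a k) * v ^ k) sums (of_real c * A v + of_real d * B v)"
  using sums_add[OF sums_mult[OF A_sums[of v], of "of_real c"]
      sums_mult[OF B_sums[of v], of "of_real d"]]
  by (simp add: algebra_simps)

text \<open>Since \<open>a (Suc k) / a k = q k / (k + 1)\<close> with \<open>q k \<le> 1\<close>, it
  is enough that \<open>(c + d * k) * (k + 1)\<close> exceeds \<open>c + d * (k + 1)\<close> by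
  \<open>c * k + d * (k^2 - 1)\<close>, which is nonnegative from \<open>k = 1\<close> on.\<close>

lemma weighted_a_decreasing:
  assumes "c \<ge> 0" "d \<ge> 0" "k \<ge> 1"
  shows "(c + d * real (Suc k)) * a (Suc k) \<le> (c + d * real k) * a k"
proof -
  have "(c + d * real (Suc k)) * q k \<le> c + d * real (Suc k)"
    using assms by (intro mult_left_le q_le_1) auto
  also have "\<dots> \<le> (c + d * real k) * (real k + 1)"
  proof -
    have "d * 1 \<le> d * (real k * real k)"
      using assms mult_mono[of 1 "real k" 1 "real k"] by (intro mult_left_mono) auto
    moreover have "0 \<le> c * real k" using assms by simp
    ultimately show ?thesis by (simp add: algebra_simps)
  qed
  finally have "(c + d * real (Suc k)) * q k / (real k + 1) \<le> c + d * real k"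
    by (subst pos_divide_le_eq) auto
  from mult_right_mono[OF this, of "a k"] a_pos[of k] show ?thesis
    by (simp add: a_Suc mult_ac)
qed

text \<open>
  Writing \<open>y = p * B v / A v\<close>, the condition \<open>Re y > -1\<close> is \<open>norm y < norm (2 + y)\<close>.
  Multiplying both \<open>p * B v\<close> and \<open>2 * A v + p * B v\<close> by \<open>1 - v\<close> gives almost all Taylor
  coefficients a known sign, which makes the triangle inequality sharp enough.
\<close>
lemma Re_gt_if:
  fixes v :: complex
  assumes p: "p \<ge> 0" and v: "norm v \<le> t" and t: "2 * p * t < (1 - t) * (A t + p * B t)"
  shows "A v \<noteq> 0" "Re (1 + of_real p * (B v / A v)) > 0"
proof -
  note bound = norm_one_minus_times_powser[OF A_plus_B_sums[of c p t for c, unfolded of_real_eq_id id_apply]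
      A_plus_B_sums[of c p v for c] _ _ v]
  have 1: "norm ((1 - v) * (of_real p * B v)) \<le> 2 * p * t - (1 - t) * (p * B t)"
    using bound[of 0] p weighted_a_decreasing[of 0 p] by simp
  have 2: "norm ((1 - v) * (2 * A v + of_real p * B v) - 2)
      \<le> 2 * p * t - ((1 - t) * (2 * A t + p * B t) - 2)"
    using bound[of 2] p weighted_a_decreasing[of 2 p] by simp
  have "2 - norm ((1 - v) * (2 * A v + of_real p * B v))
      \<le> norm ((1 - v) * (2 * A v + of_real p * B v) - 2)"
    using norm_triangle_ineq2[of 2 "(1 - v) * (2 * A v + of_real p * B v)"]
    by (simp add: norm_minus_commute)
  \<comment> \<open>The two bounds together put the difference of these norms at no less than
    \<open>2 * ((1 - t) * (A t + p * B t) - 2 * p * t)\<close>.\<close>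
  with 1 2 t have "norm ((1 - v) * (of_real p * B v)) < norm ((1 - v) * (2 * A v + of_real p * B v))"
    by (simp add: algebra_simps)
  hence lt: "norm (of_real p * B v) < norm (2 * A v + of_real p * B v)"
    by (simp add: norm_mult mult_less_cancel_left)
  \<comment> \<open>If \<open>A v\<close> were 0, both norms in \<open>lt\<close> would
    coincide.\<close>
  thus nz: "A v \<noteq> 0" by auto
  define y where "y = of_real p * (B v / A v)"
  have "norm (y * A v) < norm ((2 + y) * A v)"
    using lt nz by (simp add: y_def distrib_right)
  hence "norm y < norm (2 + y)"
    using nz by (simp add: norm_mult)
  hence "(norm y)\<^sup>2 < (norm (2 + y))\<^sup>2"
    by (intro power_strict_mono) auto
  thus "Re (1 + of_real p * (B v / A v)) > 0"
    unfolding y_def[symmetric] cmod_power2 by (simp add: power2_eq_square algebra_simps)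
qed

text \<open>At \<open>t = 1 / (1 + p)\<close> one has \<open>1 - t = p * t\<close>, so the claim
  reduces to \<open>2 < A t + p * B t\<close>. The first two terms \<open>1 + (1 + p) * t\<close>
  already give 2, and the quadratic term is positive.\<close>

lemma lower_condition:
  fixes p :: real
  assumes "p > 0"
  shows "2 * p * (1 / (1 + p)) < (1 - 1 / (1 + p)) * (A (1 / (1 + p)) + p * B (1 / (1 + p)))"
proof -
  define t where "t = 1 / (1 + p)"
  have t: "t > 0" using assms by (simp add: t_def)
  have s: "(\<lambda>k. (1 + p * real k) * a k * t ^ k) sums (A t + p * B t)"
    using A_plus_B_sums[of 1 p t] by simp
  have "(\<Sum>k\<in>{..<3}. (1 + p * real k) * a k * t ^ k) \<le> A t + p * B t"
    unfolding sums_unique[OF s]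
    by (rule sum_le_suminf) (use s t assms in \<open>auto simp: sums_iff less_imp_le[OF a_pos]
          intro!: mult_nonneg_nonneg\<close>)
  moreover have "(\<Sum>k\<in>{..<3}. (1 + p * real k) * a k * t ^ k)
      = 2 + (1 + 2 * p) * a 2 * t ^ 2"
    using assms by (simp add: eval_nat_numeral t_def field_simps)
  moreover have "(1 + 2 * p) * a 2 * t ^ 2 > 0"
    using t assms a_pos[of 2] by simp
  ultimately have "2 < A t + p * B t" by linarith
  moreover have "1 - t = p * t" using assms by (simp add: t_def field_simps)
  moreover have "p * t > 0" using assms t by simp
  ultimately have "p * t * 2 < (1 - t) * (A t + p * B t)"
    by (simp only: mult_less_cancel_left_pos)
  thus ?thesis
    unfolding t_def[symmetric] by (simp add: mult_ac)
qed

text \<open>From \<open>(k + 1) * a (k + 1) = a k * q k\<close>, the coefficients of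
  \<open>B (- t) + t * A (- t)\<close> carry the factor \<open>1 - q k\<close>. The slope condition
  makes the resulting alternating series decreasing in absolute value, and \<open>q 1 < 1\<close>
  makes the inequality strict.\<close>

lemma upper_condition_1:
  fixes t :: real
  assumes t: "0 < t" "t \<le> 1" and q1: "q 1 < 1"
  shows "B (- t) < - t * A (- t)"
proof -
  define e where "e k = a (Suc k) * (1 - q (Suc k)) * t ^ (k + 2)" for k
  have e_nonneg: "e k \<ge> 0" for k
    using a_pos[of "Suc k"] q_le_1[of "Suc k"] t by (simp add: e_def)
  \<comment> \<open>The ratio of consecutive terms contains
    \<open>(1 - q (k + 2)) / (1 - q (k + 1))\<close>, which the slope condition bounds by
    \<open>(k + 2) / (k + 1)\<close>. The form without division also covers
    \<open>q (k + 1) = 1\<close>.\<close>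
  have e_le: "e (Suc k) * (real k + 1) \<le> q 1 * t * e k" for k
  proof -
    have "(real k + 1) * (1 - q (Suc (Suc k))) \<le> (real k + 2) * (1 - q (Suc k))"
      using q_slope[of "Suc k"] by (simp add: algebra_simps)
    moreover have "q (Suc k) \<le> q 1"
      using q_Suc_le lift_Suc_antimono_le[of q 1 "Suc k"] by simp
    moreover have "0 \<le> (real k + 1) * (1 - q (Suc (Suc k)))"
      using q_le_1[of "Suc (Suc k)"] by (intro mult_nonneg_nonneg) auto
    ultimately have "q (Suc k) * ((real k + 1) * (1 - q (Suc (Suc k))))
        \<le> q 1 * ((real k + 2) * (1 - q (Suc k)))"
      using less_imp_le[OF q_pos[of 1]] by - (rule mult_mono)
    moreover have "a (Suc k) / (real k + 2) * t ^ (k + 3) \<ge> 0"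
      using t a_pos[of "Suc k"] by simp
    ultimately have "q (Suc k) * ((real k + 1) * (1 - q (Suc (Suc k)))) * (a (Suc k) / (real k + 2) * t ^ (k + 3))
       \<le> q 1 * ((real k + 2) * (1 - q (Suc k))) * (a (Suc k) / (real k + 2) * t ^ (k + 3))"
      by (rule mult_right_mono)
    thus ?thesis
      by (simp add: e_def a_Suc[of "Suc k"] eval_nat_numeral mult_ac add_ac)
  qed
  have qt: "q 1 * t < 1"
  proof -
    have "q 1 * t \<le> q 1 * 1" using t less_imp_le[OF q_pos] by (intro mult_left_mono)
    thus ?thesis using q1 by simp
  qed
  have e_Suc: "e (Suc k) \<le> e k" for k
  proof -
    have "e (Suc k) * 1 \<le> e (Suc k) * (real k + 1)"
      by (intro mult_left_mono e_nonneg) auto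
    also have "\<dots> \<le> q 1 * t * e k" by (rule e_le)
    also have "\<dots> \<le> 1 * e k" using qt e_nonneg by (intro mult_right_mono) auto
    finally show ?thesis by simp
  qed
  have "e 0 > 0" using t q1 a_pos[of 1] by (simp add: e_def)
  have e1: "e 1 < e 0"
    using e_le[of 0] mult_strict_right_mono[OF qt \<open>e 0 > 0\<close>] by simp
  have "(\<lambda>k. real (Suc k) * a (Suc k) * (- t) ^ Suc k) sums B (- t)"
    using B_sums[of "- t"] by (subst sums_Suc_iff[of "\<lambda>k. real k * a k * (- t) ^ k"]) simp
  from sums_add[OF this sums_mult[OF A_sums[of "- t"], of t]]
  have "(\<lambda>k. real (Suc k) * a (Suc k) * (- t) ^ Suc k + t * (a k * (- t) ^ k)) sums
      (B (- t) + t * A (- t))" by simp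
  also have "(\<lambda>k. real (Suc k) * a (Suc k) * (- t) ^ Suc k + t * (a k * (- t) ^ k)) =
      (\<lambda>k. a k * (1 - q k) * t * (- t) ^ k)"
  proof
    fix k
    have "real (Suc k) * a (Suc k) = a k * q k" by (simp add: a_Suc field_simps)
    thus "real (Suc k) * a (Suc k) * (- t) ^ Suc k + t * (a k * (- t) ^ k) = a k * (1 - q k) * t * (- t) ^ k"
      by (simp add: algebra_simps)
  qed
  \<comment> \<open>The term \<open>k = 0\<close> vanishes because \<open>q 0 = 1\<close>, so the
    series begins with the negative term \<open>- e 0\<close>.\<close>
  finally have "(\<lambda>k. a (Suc k) * (1 - q (Suc k)) * t * (- t) ^ Suc k) sums (B (- t) + t * A (- t))"
    by (subst sums_Suc_iff[of "\<lambda>k. a k * (1 - q k) * t * (- t) ^ k"]) (simp add: q_0)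
  also have "(\<lambda>k. a (Suc k) * (1 - q (Suc k)) * t * (- t) ^ Suc k) = (\<lambda>k. - ((-1) ^ k * e k))"
    by (rule ext) (simp add: e_def power_minus[of t] mult_ac)
  finally have "(\<lambda>k. - ((-1) ^ k * e k)) sums (B (- t) + t * A (- t))" .
  from sums_minus[OF this] have s: "(\<lambda>k. (-1) ^ k * e k) sums - (B (- t) + t * A (- t))"
    by simp
  show ?thesis
    using alternating_suminf_le(2)[OF sums_summable[OF s] e_nonneg e_Suc] e1 sums_unique[OF s]
    by simp
qed

text \<open>The terms from \<open>k = 2\<close> on alternate and decrease in absolute value, so
  their sum is at most the first of them, where \<open>a 2 = q 1 / 2\<close>.\<close>

lemma upper_condition_2:
  fixes t p :: real
  assumes t: "0 < t" "t \<le> 1" and p: "p \<ge> 0"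
  shows "A (- t) + p * B (- t) \<le> 1 - (1 + p) * t + (1 + 2 * p) * q 1 / 2 * t\<^sup>2"
proof -
  define e where "e k = (1 + p * real (k + 2)) * a (k + 2) * t ^ (k + 2)" for k
  have e_nonneg: "e k \<ge> 0" for k
    using a_pos[of "k + 2"] t p by (simp add: e_def)
  have e_Suc: "e (Suc k) \<le> e k" for k
  proof -
    have "t ^ (Suc (k + 2)) \<le> t ^ (k + 2)" using t by (intro power_decreasing) auto
    hence "(1 + p * real (Suc (k + 2))) * a (Suc (k + 2)) * t ^ (Suc (k + 2)) \<le>
       (1 + p * real (k + 2)) * a (k + 2) * t ^ (k + 2)"
      using weighted_a_decreasing[of 1 p "k + 2"] t p a_pos[of "k + 2"]
      by (intro mult_mono[OF _ _ mult_nonneg_nonneg]) auto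
    thus ?thesis by (simp add: e_def)
  qed
  have "(\<lambda>k. (1 + p * real k) * a k * (- t) ^ k) sums (A (- t) + p * B (- t))"
    using A_plus_B_sums[of 1 p "- t"] by simp
  hence "(\<lambda>k. (1 + p * real (k + 2)) * a (k + 2) * (- t) ^ (k + 2)) sums
      (A (- t) + p * B (- t) - (\<Sum>k<2. (1 + p * real k) * a k * (- t) ^ k))"
    by (rule sums_split_initial_segment)
  also have "(\<lambda>k. (1 + p * real (k + 2)) * a (k + 2) * (- t) ^ (k + 2)) = (\<lambda>k. (-1) ^ k * e k)"
    by (auto simp: e_def power_minus[of t] mult_ac)
  finally have "(\<lambda>k. (-1) ^ k * e k) sums (A (- t) + p * B (- t) - (1 - (1 + p) * t))"
    by (simp add: eval_nat_numeral)
  from alternating_suminf_le(1)[OF sums_summable[OF this] e_nonneg e_Suc] sums_unique[OF this]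
  have "A (- t) + p * B (- t) - (1 - (1 + p) * t) \<le> e 0" by simp
  also have "e 0 = (1 + 2 * p) * q 1 / 2 * t\<^sup>2"
    using a_2 by (simp add: e_def numeral_2_eq_2)
  finally show ?thesis by linarith
qed

section \<open>The radius of starlikeness of \<open>z * A (- S * z ^ p)\<close>\<close>

definition F :: "real \<Rightarrow> nat \<Rightarrow> complex \<Rightarrow> complex" where
  "F S p z = z * A (- (of_real S * z ^ p))"

text \<open>The chain rule gives \<open>z * v' = p * v\<close> for \<open>v = - S * z ^ p\<close>,
  which turns \<open>A'\<close> into \<open>B\<close>. At a zero of \<open>A v\<close> both sides
  are 0 by division by zero.\<close>

lemma F_quotient:
  fixes S :: real and p :: nat
  assumes "z \<noteq> 0" "p \<ge> 1"
  defines "v \<equiv> - (of_real S * z ^ p)"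
  shows "z * deriv (F S p) z / F S p z = (A v + of_nat p * B v) / A v"
proof -
  obtain D where D: "(A has_field_derivative D) (at v)" "v * D = B v"
    by (rule A_deriv)
  have "((\<lambda>z. - (of_real S * z ^ p)) has_field_derivative - (of_real S * (of_nat p * z ^ (p - 1)))) (at z)"
    by (auto intro!: derivative_eq_intros)
  from DERIV_chain2[where f = A and g = "\<lambda>z. - (of_real S * z ^ p)", OF D(1)[unfolded v_def] this]
  have "((\<lambda>z. A (- (of_real S * z ^ p))) has_field_derivative
      D * - (of_real S * (of_nat p * z ^ (p - 1)))) (at z)" .
  from DERIV_mult[OF DERIV_ident this]
  have "(F S p has_field_derivative A v + D * (- (of_real S * (of_nat p * z ^ (p - 1)))) * z) (at z)"
    unfolding F_def
    by (simp add: v_def)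
  hence d: "deriv (F S p) z = A v + D * (- (of_real S * (of_nat p * z ^ (p - 1)))) * z"
    by (rule DERIV_imp_deriv)
  have "z ^ (p - 1) * z = z ^ p" using assms by (cases p) auto
  hence "deriv (F S p) z = A v + of_nat p * (v * D)"
    unfolding d v_def by (simp add: algebra_simps)
  thus ?thesis using assms(1) D(2) by (simp add: F_def flip: v_def)
qed

text \<open>The condition of \<open>Re_gt_if\<close> is strict at \<open>R\<close> and continuous in
  the radius, so it persists at some \<open>r > R\<close>; this makes the bound strict.\<close>

lemma starlike_radius_gt:
  assumes S: "S > 0" and p: "p \<ge> 1" and R: "R > 0" "S * R ^ p = 1 / (1 + real p)"
  shows "ereal R < starlike_radius (F S p)"
proof -
  define L where "L t = (1 - t) * (A t + p * B t) - 2 * p * t" for t :: real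
  have cL: "isCont L t" for t :: real
    unfolding L_def by (intro continuous_intros isCont_A isCont_B)
  have cL': "isCont (\<lambda>r. L (S * r ^ p)) R"
    by (intro isCont_o2[OF _ cL] continuous_intros)
  have "0 < L (S * R ^ p)"
    using lower_condition[of p] p R by (simp add: L_def)
  hence "\<forall>\<^sub>F r in at R. 0 < L (S * r ^ p)"
    using order_tendstoD(1)[of "\<lambda>r. L (S * r ^ p)"] cL' by (simp add: isCont_def)
  hence "\<forall>\<^sub>F r in at_right R. 0 < L (S * r ^ p)"
    by (simp add: eventually_at_split)
  moreover have "\<forall>\<^sub>F r in at_right R. R < r"
    by (simp add: eventually_at_right_less)
  ultimately have "\<forall>\<^sub>F r in at_right R. 0 < L (S * r ^ p) \<and> R < r"
    by eventually_elim auto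
  then obtain r where r: "0 < L (S * r ^ p)" "R < r"
    using eventually_happens'[of "at_right R"] by (auto simp: trivial_limit_at_right_real)
  have "Re (if z = 0 then 1 else z * deriv (F S p) z / F S p z) > 0" if z: "cmod z < r" for z
  proof (cases "z = 0")
    case False
    define v where "v = - (of_real S * z ^ p)"
    have "norm v \<le> S * r ^ p"
      using z S unfolding v_def norm_minus_cancel norm_mult norm_power
      by (intro mult_mono power_mono) auto
    moreover have "2 * real p * (S * r ^ p) < (1 - S * r ^ p) * (A (S * r ^ p) + p * B (S * r ^ p))"
      using r by (simp add: L_def)
    ultimately have "A v \<noteq> 0" "Re (1 + of_real (real p) * (B v / A v)) > 0"
      by (intro Re_gt_if[of "real p" v "S * r ^ p"]; simp)+
    thus ?thesis
      using False F_quotient[OF False p, of S] unfolding v_def[symmetric]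
      by (simp add: add_divide_distrib)
  qed simp
  hence "ereal r \<le> starlike_radius (F S p)"
    unfolding starlike_radius_def using r R by (intro Sup_upper) auto
  thus ?thesis using r by (meson ereal_less(2) less_ereal.simps(1) order_less_le_trans)
qed

text \<open>By continuity the negative sign persists at some \<open>r < R\<close>. Either the
  quotient is negative at the real point \<open>r\<close>, or \<open>A\<close> has changed sign
  before, and starlikeness fails at a zero.\<close>

lemma starlike_radius_less:
  assumes S: "S > 0" and p: "p \<ge> 1" and R: "R > 0"
    and neg: "A (- (S * R ^ p)) + real p * B (- (S * R ^ p)) < 0"
  shows "starlike_radius (F S p) < ereal R"
proof -
  define \<psi> where "\<psi> r = A (- (S * r ^ p)) + real p * B (- (S * r ^ p))" for r
  have cA: "isCont (\<lambda>r. A (- (S * r ^ p))) r" for r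
    by (intro isCont_o2[OF _ isCont_A] continuous_intros)
  have "isCont \<psi> R"
    unfolding \<psi>_def
    by (intro continuous_intros cA isCont_o2[OF _ isCont_B])
  hence "\<forall>\<^sub>F r in at R. \<psi> r < 0"
    using order_tendstoD(2)[of \<psi>] neg by (simp add: isCont_def \<psi>_def)
  hence "\<forall>\<^sub>F r in at_left R. \<psi> r < 0"
    by (simp add: eventually_at_split)
  moreover have "\<forall>\<^sub>F r in at_left R. r \<in> {0<..<R}"
    using R by (rule eventually_at_left_real)
  ultimately have "\<forall>\<^sub>F r in at_left R. \<psi> r < 0 \<and> r \<in> {0<..<R}"
    by eventually_elim auto
  then obtain r where r: "\<psi> r < 0" "0 < r" "r < R"
    using eventually_happens'[of "at_left R"] by (auto simp: trivial_limit_at_left_real)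
  have "\<exists>r'. 0 < r' \<and> r' \<le> r \<and> \<psi> r' / A (- (S * r' ^ p)) \<le> 0"
  proof (cases "A (- (S * r ^ p)) > 0")
    case True
    thus ?thesis using r by (intro exI[of _ r]) (auto intro: divide_nonpos_pos)
  next
    case False
    \<comment> \<open>\<open>A\<close> equals 1 at the origin. At the zero found here the quotient
      has the value 0, hence is not positive.\<close>
    hence "\<exists>x\<ge>0. x \<le> r \<and> A (- (S * x ^ p)) = 0"
      using cA r p by (intro IVT2) (auto simp: power_0_left)
    then obtain x where x: "0 \<le> x" "x \<le> r" "A (- (S * x ^ p)) = 0" by blast
    moreover have "x \<noteq> 0"
      using x(3) p by (intro notI) (simp add: power_0_left)
    ultimately show ?thesis by (intro exI[of _ x]) auto
  qed
  then obtain r' where r': "0 < r'" "r' \<le> r" "\<psi> r' / A (- (S * r' ^ p)) \<le> 0" by blast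
  have v: "- (of_real S * of_real r' ^ p) = complex_of_real (- (S * r' ^ p))" by simp
  have "of_real r' * deriv (F S p) (of_real r') / F S p (of_real r')
      = complex_of_real (\<psi> r' / A (- (S * r' ^ p)))"
    using F_quotient[of "of_real r'" p S] r'(1) p unfolding v A_of_real B_of_real \<psi>_def
    by simp
  hence "Re (of_real r' * deriv (F S p) (of_real r') / F S p (of_real r')) \<le> 0"
    using r'(3) by (simp only: Re_complex_of_real)
  hence "s \<le> r'" if "\<forall>z. cmod z < s \<longrightarrow>
      Re (if z = 0 then 1 else z * deriv (F S p) z / F S p z) > 0" for s
    using that[rule_format, of "of_real r'"] r'(1) by (cases "r' < s") auto
  hence "starlike_radius (F S p) \<le> ereal r'"
    unfolding starlike_radius_def by (intro Sup_least) auto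
  thus ?thesis using r' r by (simp add: le_less_trans)
qed

text \<open>For \<open>t = 1 / p\<close>, multiplying \<open>upper_condition_1\<close> by
  \<open>p\<close> gives exactly \<open>A + p * B < 0\<close> at \<open>- t\<close>.\<close>

lemma starlike_radius_less_1:
  assumes "S > 0" "p \<ge> 1" "R > 0" "S * R ^ p = 1 / real p" "q 1 < 1"
  shows "starlike_radius (F S p) < ereal R"
proof (rule starlike_radius_less)
  have "B (- (1 / real p)) < - (1 / real p) * A (- (1 / real p))"
    using assms by (intro upper_condition_1) auto
  from mult_strict_left_mono[OF this, of "real p"] assms
  show "A (- (S * R ^ p)) + real p * B (- (S * R ^ p)) < 0" by simp
qed (use assms in auto)

lemma starlike_radius_less_le_trans:
  assumes "starlike_radius f < ereal R" "R \<le> R'"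
  shows "starlike_radius f < ereal R'"
  using assms by (meson ereal_less_eq(3) order_less_le_trans)

text \<open>If \<open>S * R ^ p \<ge> 1 / p\<close>, the previous bound is the stronger one.\<close>
lemma starlike_radius_less_2:
  assumes "S > 0" "p \<ge> 1" "R > 0" "q 1 < 1"
    and eq: "S * R ^ p * ((1 + real p) - (1 + 2 * real p) * q 1 / (1 + real p)) = 1"
  shows "starlike_radius (F S p) < ereal R"
proof -
  define t where "t = S * R ^ p"
  have t0: "t > 0" using assms by (simp add: t_def)
  show ?thesis
  proof (cases "t < 1 / real p")
    case True
    have "1 / real p \<le> 1" using assms by simp
    have "1 / real p \<le> 2 / (1 + real p)" using assms by (simp add: field_simps)
    hence t: "t < 2 / (1 + real p)" using True by linarith
    define h where "h = 1 / (1 + real p)"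
    have "t * ((1 + real p) - (1 + 2 * real p) * q 1 * h) = 1"
      using eq by (simp add: t_def h_def)
    \<comment> \<open>Replacing the constant 1 by means of \<open>eq\<close> cancels the linear
      term; the remaining product is negative because \<open>t < 2 / (1 + p)\<close>.\<close>
    hence "1 - (1 + real p) * t + (1 + 2 * real p) * q 1 / 2 * t\<^sup>2
        = (1 + 2 * real p) * q 1 * t * (t / 2 - h)"
      by (simp add: algebra_simps power2_eq_square)
    also have "\<dots> < 0"
      using t t0 q_pos[of 1] by (intro mult_pos_neg) (auto simp: h_def)
    finally have "A (- t) + real p * B (- t) < 0"
      using upper_condition_2[of t "real p"] t0 True \<open>1 / real p \<le> 1\<close> by linarith
    thus ?thesis using starlike_radius_less assms by (simp add: t_def)
  next
    case False
    \<comment> \<open>The radius of \<open>starlike_radius_less_1\<close>, which is at most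
      \<open>R\<close> in this case.\<close>
    define R' where "R' = root p (1 / (real p * S))"
    have R': "R' > 0" "S * R' ^ p = 1 / real p"
      using assms by (simp_all add: R'_def)
    have "R' ^ p \<le> R ^ p"
    proof -
      have "S * R' ^ p \<le> S * R ^ p" using False R'(2) by (simp add: t_def)
      thus ?thesis using assms(1) by simp
    qed
    hence "R' \<le> R" using assms R' by (simp add: power_mono_iff)
    thus ?thesis
      using starlike_radius_less_1[of S p R'] assms R' starlike_radius_less_le_trans by blast
  qed
qed

end

section \<open>The coefficient ratios of the Bessel series\<close>

text \<open>The slope condition follows from \<open>1 - r * s = (1 - r) + r * (1 - s)\<close> and
  the monotonicity of \<open>r\<close>.\<close>

lemma normalized_ratios_mult:
  assumes "normalized_ratios r" "normalized_ratios s"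
  shows "normalized_ratios (\<lambda>k. r k * s k)"
proof -
  interpret r: normalized_ratios r by fact
  interpret s: normalized_ratios s by fact
  show ?thesis
  proof
    fix k
    show "r (Suc k) * s (Suc k) \<le> r k * s k"
      using r.q_Suc_le[of k] s.q_Suc_le[of k] r.q_pos[of k] s.q_pos[of "Suc k"]
      by (intro mult_mono) auto
    have "0 \<le> real k * (1 - s (Suc k))"
      using s.q_le_1[of "Suc k"] by simp
    hence "r (Suc k) * (real k * (1 - s (Suc k))) \<le> r k * ((real k + 1) * (1 - s k))"
      using r.q_Suc_le[of k] s.q_slope[of k] less_imp_le[OF r.q_pos[of k]]
      by - (rule mult_mono)
    with r.q_slope[of k]
    show "real k * (1 - r (Suc k) * s (Suc k)) \<le> (real k + 1) * (1 - r k * s k)"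
      by (simp add: algebra_simps)
  qed (simp_all add: r.q_0 s.q_0 r.q_pos s.q_pos)
qed

text \<open>Here \<open>1 - q k\<close> is a nonnegative constant times
  \<open>2 * k / (2 * k + y)\<close>, which increases with \<open>k\<close> but decreases after
  division by \<open>k\<close>.\<close>

lemma normalized_ratios_moebius:
  assumes "y > 0" "m \<ge> 0"
  shows "normalized_ratios (\<lambda>k. y * (2 * real k + y + m) / ((y + m) * (2 * real k + y)))"
proof
  fix k :: nat
  let ?u = "\<lambda>k. y * (2 * real k + y + m) / ((y + m) * (2 * real k + y))"
  have 1: "1 - ?u k = m / (y + m) * (2 * real k / (2 * real k + y))" for k
  proof -
    have "y + m \<noteq> 0" "2 * real k + y \<noteq> 0" using assms by auto
    thus ?thesis by (simp add: divide_simps) (simp add: algebra_simps)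
  qed
  have c: "0 \<le> m / (y + m)" using assms by simp
  show "?u 0 = 1" using assms by simp
  show "0 < ?u k" using assms by (intro divide_pos_pos mult_pos_pos) auto
  have "2 * real k * (2 * real (Suc k) + y) \<le> 2 * real (Suc k) * (2 * real k + y)"
    using assms by (simp add: algebra_simps)
  hence "2 * real k / (2 * real k + y) \<le> 2 * real (Suc k) / (2 * real (Suc k) + y)"
    using assms by (subst pos_divide_le_eq) (auto simp: pos_le_divide_eq)
  hence "m / (y + m) * (2 * real k / (2 * real k + y))
      \<le> m / (y + m) * (2 * real (Suc k) / (2 * real (Suc k) + y))"
    by (intro mult_left_mono c)
  thus "?u (Suc k) \<le> ?u k" using 1[of k] 1[of "Suc k"] by linarith
  have "m / (y + m) * (2 * real k * (real k + 1) / (2 * real (Suc k) + y))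
      \<le> m / (y + m) * (2 * real k * (real k + 1) / (2 * real k + y))"
    using assms by (intro mult_left_mono c divide_left_mono mult_pos_pos) auto
  thus "real k * (1 - ?u (Suc k)) \<le> (real k + 1) * (1 - ?u k)"
    unfolding 1 by (simp add: mult_ac add_ac)
qed

text \<open>Up to the factor \<open>k + 1\<close> and a constant, this is the quotient of
  consecutive \<open>bcoeff\<close>, normalized to 1 at \<open>k = 0\<close>. Two factors come from
  the Gamma functions whose argument moves by 2, written to fit
  \<open>normalized_ratios_moebius\<close>; the third comes from
  \<open>Gamma (k + \<nu> + 1)\<close>.\<close>

definition bessel_ratio :: "real \<Rightarrow> nat \<Rightarrow> nat \<Rightarrow> real" where
  "bessel_ratio \<nu> n k = (let x = \<nu> - real n + 1 in
     x * (2 * real k + x + real n) / ((x + real n) * (2 * real k + x)) *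
     ((x + 1) * (2 * real k + (x + 1) + real n) / (((x + 1) + real n) * (2 * real k + (x + 1)))) *
     ((\<nu> + 1) / (real k + \<nu> + 1)))"

context
  fixes \<nu> :: real and n :: nat
  assumes \<nu>: "\<nu> > real n - 1"
begin

lemma normalized_ratios_bessel: "normalized_ratios (bessel_ratio \<nu> n)"
proof -
  \<comment> \<open>This factor is the limit of the ratios in
    \<open>normalized_ratios_moebius\<close> for \<open>y = 2 * (\<nu> + 1)\<close> as
    \<open>m\<close> tends to infinity, and the same argument applies.\<close>
  have "normalized_ratios (\<lambda>k. (\<nu> + 1) / (real k + \<nu> + 1))"
  proof
    fix k :: nat
    have \<nu>: "\<nu> + 1 > 0" using \<nu> by linarith
    have 1: "1 - (\<nu> + 1) / (real k + \<nu> + 1) = real k / (real k + \<nu> + 1)" for k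
    proof -
      have "real k + \<nu> + 1 \<noteq> 0" using \<nu> by linarith
      thus ?thesis by (simp add: divide_simps)
    qed
    show "(\<nu> + 1) / (real 0 + \<nu> + 1) = 1" "0 < (\<nu> + 1) / (real k + \<nu> + 1)"
      using \<nu> by auto
    show "(\<nu> + 1) / (real (Suc k) + \<nu> + 1) \<le> (\<nu> + 1) / (real k + \<nu> + 1)"
      using \<nu> by (intro divide_left_mono mult_pos_pos) auto
    have "real k * (real k + 1) / (real (Suc k) + \<nu> + 1) \<le> real k * (real k + 1) / (real k + \<nu> + 1)"
      using \<nu> by (intro divide_left_mono mult_pos_pos) auto
    thus "real k * (1 - (\<nu> + 1) / (real (Suc k) + \<nu> + 1)) \<le>
        (real k + 1) * (1 - (\<nu> + 1) / (real k + \<nu> + 1))"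
      unfolding 1 by (simp add: mult_ac add_ac)
  qed
  thus ?thesis
    unfolding bessel_ratio_def Let_def using \<nu>
    by (intro normalized_ratios_mult normalized_ratios_moebius) auto
qed

interpretation normalized_ratios "bessel_ratio \<nu> n" by (rule normalized_ratios_bessel)

text \<open>Strictness comes from the third factor; for \<open>n = 0\<close> the other two equal
  1.\<close>

lemma bessel_ratio_1_less: "bessel_ratio \<nu> n 1 < 1"
proof -
  let ?x = "\<nu> - real n + 1"
  have u: "y * (2 * real 1 + y + real n) / ((y + real n) * (2 * real 1 + y)) \<le> 1"
    "0 < y * (2 * real 1 + y + real n) / ((y + real n) * (2 * real 1 + y))" if "y > 0" for y
    using normalized_ratios.q_le_1[OF normalized_ratios_moebius[of y "real n"], of 1]
      normalized_ratios.q_pos[OF normalized_ratios_moebius[of y "real n"], of 1] that by auto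
  have x: "?x > 0" "?x + 1 > 0" using \<nu> by auto
  have w: "(\<nu> + 1) / (real 1 + \<nu> + 1) < 1" "0 < (\<nu> + 1) / (real 1 + \<nu> + 1)" using \<nu> by auto
  have "bessel_ratio \<nu> n 1 \<le> 1 * 1 * ((\<nu> + 1) / (real 1 + \<nu> + 1))"
    unfolding bessel_ratio_def Let_def using u[OF x(1)] u[OF x(2)] w
    by (intro mult_mono mult_nonneg_nonneg) (auto simp only: less_imp_le mult_1 zero_le_one)
  with w show ?thesis by simp
qed

text \<open>This is \<open>- bcoeff \<nu> n 1\<close>, as forced by \<open>a 1 = 1\<close>.\<close>

definition bessel_scale :: real where
  "bessel_scale = (\<nu> + 2) / (4 * ((\<nu> - real n + 2) * (\<nu> - real n + 1)))"

lemma bessel_scale_pos: "bessel_scale > 0"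
  using \<nu> by (auto simp: bessel_scale_def intro!: divide_pos_pos mult_pos_pos)

lemma bcoeff_eq: "bcoeff \<nu> n m = a m * (- bessel_scale) ^ m"
proof (induction m)
  case 0
  have "Gamma (\<nu> + 1) > 0" "Gamma (\<nu> - real n + 1) > 0"
    using \<nu> by (auto intro!: Gamma_real_pos)
  thus ?case by (simp add: bcoeff_def algebra_simps)
next
  case (Suc m)
  define x where "x = \<nu> - real n + 1"
  have x: "x > 0" "\<nu> = x + real n - 1" using \<nu> by (auto simp: x_def)
  have pos: "2 * real m + \<nu> + 1 > 0" "2 * real m + \<nu> + 2 > 0"
    "2 * real m + x > 0" "2 * real m + x + 1 > 0" "real m + \<nu> + 1 > 0" "\<nu> + 1 > 0" "\<nu> + 2 > 0"
    using x by linarith+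
  have two: "Gamma (y + 2) = (y + 1) * y * Gamma y" if "y > 0" for y :: real
    using Gamma_pos_Suc[of y] Gamma_pos_Suc[of "y + 1"] that by (simp add: add.assoc)
  have G1: "Gamma (2 * real (Suc m) + \<nu> + 1) =
      (2 * real m + \<nu> + 2) * (2 * real m + \<nu> + 1) * Gamma (2 * real m + \<nu> + 1)"
    using two[OF pos(1)] by (simp add: add_ac)
  have "2 * real (Suc m) - real n + \<nu> + 1 = 2 * real m + x + 2"
    "2 * real m - real n + \<nu> + 1 = 2 * real m + x" by (auto simp: x_def)
  note e = this
  have G2: "Gamma (2 * real (Suc m) - real n + \<nu> + 1) =
      (2 * real m + x + 1) * (2 * real m + x) * Gamma (2 * real m - real n + \<nu> + 1)"
    unfolding e by (rule two[OF pos(3)])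
  have G3: "Gamma (real (Suc m) + \<nu> + 1) = (real m + \<nu> + 1) * Gamma (real m + \<nu> + 1)"
    using Gamma_pos_Suc[OF pos(5)] by (simp add: add_ac)
  have "bcoeff \<nu> n (Suc m) = bcoeff \<nu> n m *
     (- ((2 * real m + \<nu> + 2) * (2 * real m + \<nu> + 1)) /
        (4 * (real m + 1) * ((2 * real m + x + 1) * (2 * real m + x)) * (real m + \<nu> + 1)))"
    unfolding bcoeff_def G1 G2 G3 by (simp add: algebra_simps)
  \<comment> \<open>The constants that normalize \<open>bessel_ratio\<close> multiply to
    \<open>x * (x + 1) / (\<nu> + 2)\<close> and cancel against \<open>bessel_scale\<close>.\<close>
  also have "- ((2 * real m + \<nu> + 2) * (2 * real m + \<nu> + 1)) /
        (4 * (real m + 1) * ((2 * real m + x + 1) * (2 * real m + x)) * (real m + \<nu> + 1)) =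
      bessel_ratio \<nu> n m / (real m + 1) * (- bessel_scale)"
  proof -
    have e: "x + real n = \<nu> + 1" "2 * real m + x + real n = 2 * real m + \<nu> + 1"
      "x + 1 + real n = \<nu> + 2" "2 * real m + (x + 1) + real n = 2 * real m + \<nu> + 2"
      "\<nu> - real n + 2 = x + 1" "2 * real m + (x + 1) = 2 * real m + x + 1"
      "2 * real m + x + 1 + real n = 2 * real m + \<nu> + 2"
      using x by auto
    have "x + 1 \<noteq> 0" "real m + 1 \<noteq> 0" using x by linarith+
    thus ?thesis
      unfolding bessel_ratio_def bessel_scale_def Let_def x_def[symmetric] e using pos x(1)
      by (simp add: divide_simps) (simp add: algebra_simps)
  qed
  finally show ?case using Suc.IH by (simp add: a_Suc)
qed

lemma g_bessel_F: "g_bessel \<nu> n = F bessel_scale 2"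
proof
  fix z
  have "(\<lambda>m. of_real (bcoeff \<nu> n m) * z ^ (2 * m + 1)) sums F bessel_scale 2 z"
    using sums_mult[OF A_sums[of "- (of_real bessel_scale * z ^ 2)"], of z]
    unfolding F_def bcoeff_eq
    by (simp add: mult_ac power_mult_distrib power_minus[of "_ * _"] power_minus[of bessel_scale] flip: power_mult)
  with g_bessel_sums[OF \<nu>, of z] show "g_bessel \<nu> n z = F bessel_scale 2 z" by (rule sums_unique2)
qed

lemma h_bessel_F: "h_bessel \<nu> n = F bessel_scale 1"
proof
  fix z
  have "(\<lambda>m. of_real (bcoeff \<nu> n m) * z ^ (m + 1)) sums F bessel_scale 1 z"
    using sums_mult[OF A_sums[of "- (of_real bessel_scale * z ^ 1)"], of z]
    unfolding F_def bcoeff_eq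
    by (simp add: mult_ac power_mult_distrib power_minus[of "_ * _"] power_minus[of bessel_scale])
  with h_bessel_sums[OF \<nu>, of z] show "h_bessel \<nu> n z = F bessel_scale 1 z" by (rule sums_unique2)
qed

text \<open>Identifies the subtracted fractions in the sharper upper bounds as multiples of
  \<open>S * q 1\<close>.\<close>

lemma bessel_scale_ratio_1:
  "4 * bessel_scale * bessel_ratio \<nu> n 1 =
    (\<nu> + 4) * (\<nu> + 3) / ((\<nu> - real n + 4) * (\<nu> - real n + 3) * (\<nu> + 2))"
proof -
  define x where "x = \<nu> - real n + 1"
  have x: "x > 0" "\<nu> + 1 > 0" using \<nu> by (auto simp: x_def)
  have e: "x + real n = \<nu> + 1" "2 * real 1 + x + real n = \<nu> + 3"
    "x + 1 + real n = \<nu> + 2" "2 * real 1 + (x + 1) + real n = \<nu> + 4"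
    "x + 3 + real n = \<nu> + 4" "x + 2 + real n = \<nu> + 3"
    "\<nu> - real n + 2 = x + 1" "2 * real 1 + (x + 1) = x + 3" "2 * real 1 + x = x + 2"
    "\<nu> - real n + 4 = x + 3" "\<nu> - real n + 3 = x + 2" "real 1 + \<nu> + 1 = \<nu> + 2"
    by (auto simp: x_def)
  have "x + 1 \<noteq> 0" "x + 2 \<noteq> 0" "x + 3 \<noteq> 0" "\<nu> + 2 \<noteq> 0" "x \<noteq> 0" "\<nu> + 1 \<noteq> 0" using x by linarith+
  thus ?thesis
    unfolding bessel_ratio_def bessel_scale_def Let_def x_def[symmetric] e
    by (simp add: divide_simps) (simp add: algebra_simps)
qed

end

theorem theorem3p3:
  fixes n :: nat and \<nu> :: real
  assumes "\<nu> > real n - 1"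
  shows
    "(starlike_radius (g_bessel \<nu> n)
        < ereal (sqrt (2 * (\<nu> - real n + 2) * (\<nu> - real n + 1) / (\<nu> + 2))) \<and>
      ereal (2 * sqrt ((\<nu> - real n + 2) * (\<nu> - real n + 1) / (3 * (\<nu> + 2))))
        < starlike_radius (g_bessel \<nu> n) \<and>
      starlike_radius (g_bessel \<nu> n)
        < ereal (2 * sqrt (1 /
            (3 * (\<nu> + 2) / ((\<nu> - real n + 2) * (\<nu> - real n + 1))
             - 5 * (\<nu> + 4) * (\<nu> + 3) /
               (3 * (\<nu> - real n + 4) * (\<nu> - real n + 3) * (\<nu> + 2)))))) \<and>
     (starlike_radius (h_bessel \<nu> n)
        < ereal (4 * (\<nu> - real n + 2) * (\<nu> - real n + 1) / (\<nu> + 2)) \<and>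
      ereal (2 * (\<nu> - real n + 2) * (\<nu> - real n + 1) / (\<nu> + 2))
        < starlike_radius (h_bessel \<nu> n) \<and>
      starlike_radius (h_bessel \<nu> n)
        < ereal (2 /
            ((\<nu> + 2) / ((\<nu> - real n + 2) * (\<nu> - real n + 1))
             - 3 * (\<nu> + 4) * (\<nu> + 3) /
               (4 * (\<nu> - real n + 4) * (\<nu> - real n + 3) * (\<nu> + 2)))))"
proof -
  interpret normalized_ratios "bessel_ratio \<nu> n" by (rule normalized_ratios_bessel[OF assms])
  define S where "S = bessel_scale \<nu> n"
  define X where "X = (\<nu> - real n + 2) * (\<nu> - real n + 1)"
  define r where "r = bessel_ratio \<nu> n 1"
  have S: "S > 0" unfolding S_def by (rule bessel_scale_pos[OF assms])
  have X: "X > 0" and \<nu>: "\<nu> + 2 > 0" using assms by (auto simp: X_def)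
  have r: "r < 1" unfolding r_def by (rule bessel_ratio_1_less[OF assms])
  have SX: "\<nu> + 2 = 4 * S * X"
    using X by (simp add: S_def bessel_scale_def[OF assms] X_def[symmetric])
  have c: "c * (\<nu> + 4) * (\<nu> + 3) / (d * (\<nu> - real n + 4) * (\<nu> - real n + 3) * (\<nu> + 2))
      = c / d * (4 * S * r)" for c d
    using bessel_scale_ratio_1[OF assms] by (simp add: S_def r_def mult_ac)
  have F: "F S 2 = g_bessel \<nu> n" "F S 1 = h_bessel \<nu> n"
    using g_bessel_F[OF assms] h_bessel_F[OF assms] by (simp_all add: S_def)
  \<comment> \<open>The last factor is \<open>(1 + p) - (1 + 2 * p) * q 1 / (1 + p)\<close> from
    \<open>starlike_radius_less_2\<close> with \<open>p = 2\<close>; in \<open>c_h\<close> it is the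
    same with \<open>p = 1\<close>.\<close>
  have c_g: "3 * (\<nu> + 2) / X - 5 * (\<nu> + 4) * (\<nu> + 3) /
      (3 * (\<nu> - real n + 4) * (\<nu> - real n + 3) * (\<nu> + 2)) = 4 * S * (3 - 5 * r / 3)"
    unfolding c unfolding SX using X by (simp add: algebra_simps)
  have c_h: "(\<nu> + 2) / X - 3 * (\<nu> + 4) * (\<nu> + 3) /
      (4 * (\<nu> - real n + 4) * (\<nu> - real n + 3) * (\<nu> + 2)) = 2 * S * (2 - 3 * r / 2)"
    unfolding c unfolding SX using X by (simp add: algebra_simps)
  \<comment> \<open>By \<open>SX\<close> the radii of the simple bounds satisfy
    \<open>S * R ^ p = 1 / p\<close> (upper) and \<open>S * R ^ p = 1 / (1 + p)\<close>
    (lower).\<close>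
  have "starlike_radius (F S 2) < ereal (sqrt (2 * X / (\<nu> + 2)))"
    using S X \<nu> r by (intro starlike_radius_less_1) (auto simp: SX r_def)
  moreover have "ereal (2 * sqrt (X / (3 * (\<nu> + 2)))) < starlike_radius (F S 2)"
    using S X \<nu> by (intro starlike_radius_gt) (auto simp: SX power_mult_distrib)
  moreover have "starlike_radius (F S 2) < ereal (2 * sqrt (1 / (4 * S * (3 - 5 * r / 3))))"
  proof (rule starlike_radius_less_2)
    \<comment> \<open>\<open>r < 1\<close> keeps the radicand positive, so the square root is a
      genuine radius.\<close>
    have "3 - 5 * r / 3 > 0" using r by simp
    moreover define D where "D = 3 - 5 * r / 3"
    ultimately have D: "D > 0" by simp
    thus "0 < 2 * sqrt (1 / (4 * S * (3 - 5 * r / 3)))"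
      using S unfolding D_def[symmetric] by simp
    have "S * (2 * sqrt (1 / (4 * S * D)))\<^sup>2 * D = 1"
      using S D by (simp add: power_mult_distrib)
    thus "S * (2 * sqrt (1 / (4 * S * (3 - 5 * r / 3))))\<^sup>2 *
        (1 + real 2 - (1 + 2 * real 2) * bessel_ratio \<nu> n 1 / (1 + real 2)) = 1"
      by (simp add: D_def r_def)
  qed (use S r in \<open>auto simp: r_def\<close>)
  moreover have "starlike_radius (F S 1) < ereal (4 * X / (\<nu> + 2))"
    using S X \<nu> r by (intro starlike_radius_less_1) (auto simp: SX r_def)
  moreover have "ereal (2 * X / (\<nu> + 2)) < starlike_radius (F S 1)"
    using S X \<nu> by (intro starlike_radius_gt) (auto simp: SX)
  moreover have "starlike_radius (F S 1) < ereal (2 / (2 * S * (2 - 3 * r / 2)))"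
  proof (rule starlike_radius_less_2)
    have "2 - 3 * r / 2 > 0" using r by simp
    moreover define D where "D = 2 - 3 * r / 2"
    ultimately have D: "D > 0" by simp
    thus "0 < 2 / (2 * S * (2 - 3 * r / 2))"
      using S unfolding D_def[symmetric] by simp
    have "S * (2 / (2 * S * D)) ^ 1 * D = 1"
      using S D by simp
    thus "S * (2 / (2 * S * (2 - 3 * r / 2))) ^ 1 *
        (1 + real 1 - (1 + 2 * real 1) * bessel_ratio \<nu> n 1 / (1 + real 1)) = 1"
      by (simp add: D_def r_def)
  qed (use S r in \<open>auto simp: r_def\<close>)
  ultimately show ?thesis
    unfolding F c_g[symmetric] c_h[symmetric] X_def by (simp only: mult.assoc)
qed

end
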